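(* Let $\{a_n\}_{n\geq 0}$ be the Narayana sequence, defined by $a_0=0$, $a_1=a_2=1$ and $a_n=a_{n-1}+a_{n-3}$ for $n\geq 3$. For every integer $n\geq 1$, \[\nu_3(a_n) = \begin{cases} 0, &\text{ if }n\equiv 1,2,3,4,6\pmod 8;\\ 1, &\text{ if }n\equiv 5,7,13,15\pmod {24};\\ 2, &\text{ if }n\equiv 8\pmod {24};\\ \nu_3(n+1)+1, &\text{ if }n\equiv 23\pmod {24};\\ \nu_3(n+3)+1, &\text{ if }n\equiv 21\pmod {24};\\ \nu_3(n)+2, &\text{ if }n\equiv 0\pmod {24};\\ \nu_3(n+8)+2, &\text{ if }n\equiv 16\pmod {24}. \end{cases}\]
   Context: For a prime $p$ and a nonzero integer $r$, $\nu_p(r)$ denotes the $p$-adic valuation of $r$, i.e. the exponent of the highest power of $p$ dividing $r$. *)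

theory Defs
  imports "HOL-Number_Theory.Number_Theory"
begin

fun narayana :: "nat \<Rightarrow> nat" where
  "narayana 0 = 0"
| "narayana (Suc 0) = 1"
| "narayana (Suc (Suc 0)) = 1"
| "narayana (Suc (Suc (Suc n))) = narayana (Suc (Suc n)) + narayana n"

end

theory Submission
  imports Defs
begin

text \<open>
  Let \<open>x\<close> be a root of \<open>x^3 = x^2 + 1\<close>. Then \<open>x^24 = 1 + 9 B\<close> with
  \<open>B = 208 + 142 x + 305 x^2\<close>, and cubing repeatedly gives
  \<open>x^(24 * 3^j * m) \<equiv> 1 + 3^(j+2) m B\<close> modulo \<open>3^(j+4)\<close>. Extending the
  Narayana sequence to negative indices, it vanishes at \<open>0, -1, -3, -8\<close>; near these
  zeros the term \<open>3^(j+2) m B\<close> determines the valuation, since \<open>B\<close> acts there by an integer of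
  valuation at most 1. In the other residue classes modulo 24 the valuation is constant and is
  read off modulo 27.
\<close>

section \<open>Solutions of the recurrence and their shifts by multiples of 24\<close>

definition narayana_rec :: "(nat \<Rightarrow> int) \<Rightarrow> bool" where
  "narayana_rec s \<longleftrightarrow> (\<forall>n. s (n + 3) = s (n + 2) + s n)"

text \<open>The coefficients are \<open>(a\<^sub>2\<^sub>2 - 1) / 9\<close>, \<open>a\<^sub>2\<^sub>1 / 9\<close> and \<open>a\<^sub>2\<^sub>3 / 9\<close>.\<close>

definition shift24_quot :: "(nat \<Rightarrow> int) \<Rightarrow> nat \<Rightarrow> int" where
  "shift24_quot s n = 208 * s n + 142 * s (n + 1) + 305 * s (n + 2)"

lemma narayana_rec_shift24_quot: "narayana_rec s \<Longrightarrow> narayana_rec (shift24_quot s)"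
  unfolding narayana_rec_def shift24_quot_def
proof
  fix n
  assume rec: "\<forall>n. s (n + 3) = s (n + 2) + s n"
  show "208 * s (n + 3) + 142 * s (n + 3 + 1) + 305 * s (n + 3 + 2) =
        208 * s (n + 2) + 142 * s (n + 2 + 1) + 305 * s (n + 2 + 2) +
        (208 * s n + 142 * s (n + 1) + 305 * s (n + 2))"
    using rec[rule_format, of n] rec[rule_format, of "n + 1"] rec[rule_format, of "n + 2"]
    by (simp add: algebra_simps numeral_eq_Suc)
qed

lemma narayana_rec_shift3:
  assumes "narayana_rec s"
  shows "s (m + 3) = s (m + 2) + s m"
  using assms by (simp add: narayana_rec_def)

lemma narayana_rec_shift24:
  assumes "narayana_rec s"
  shows "s (n + 24) = s n + 9 * shift24_quot s n"
proof -
  note rec = narayana_rec_shift3[OF assms]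
  \<comment> \<open>The exponent 24 is reached by doubling 6 twice: x^6 = 2 + x + 3 x^2 and x^12 =
    19 + 13 x + 28 x^2.\<close>
  have s6: "s (m + 6) = 2 * s m + s (m + 1) + 3 * s (m + 2)" for m
    using rec[of m] rec[of "m + 1"] rec[of "m + 2"] rec[of "m + 3"]
    by (simp add: numeral_eq_Suc)
  have s12: "s (m + 12) = 19 * s m + 13 * s (m + 1) + 28 * s (m + 2)" for m
    using s6[of m] s6[of "m + 6"] s6[of "m + 1"] s6[of "m + 2"]
      rec[of m] rec[of "m + 1"] rec[of "m + 2"] rec[of "m + 3"] rec[of "m + 4"] rec[of "m + 5"]
    by (simp add: numeral_eq_Suc)
  show ?thesis
    using s12[of n] s12[of "n + 12"] s12[of "n + 1"] s12[of "n + 2"] rec[of n] rec[of "n + 1"]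
    by (simp add: shift24_quot_def numeral_eq_Suc)
qed

text \<open>Three shifts by \<open>T = 24 * 3 ^ j\<close> expand like (1 + P E)^3 with P = 3^(j+2).
  Removing the 1 and dividing by 3 P leaves E plus multiples of 9, because 9 divides P. The
  induction keeps \<open>s\<close> arbitrary since its hypothesis is applied in turn to the quotient
  sequences \<open>d\<close> and \<open>e\<close>.\<close>

lemma narayana_rec_shift_pow3:
  "narayana_rec s \<Longrightarrow> \<exists>d. narayana_rec d \<and> (\<forall>n. s (n + 24 * 3 ^ j) = s n + 3 ^ (j + 2) * d n) \<and>
     (\<forall>n. [d n = shift24_quot s n] (mod 9))"
proof (induction j arbitrary: s)
  case 0
  then show ?case
    using narayana_rec_shift24 narayana_rec_shift24_quot
    by (intro exI[of _ "shift24_quot s"]) auto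
next
  case (Suc j)
  define P where "P = (3::int) ^ (j + 2)"
  define T where "T = 24 * (3::nat) ^ j"
  obtain d where d: "narayana_rec d" "\<And>n. s (n + T) = s n + P * d n"
    and d_cong: "\<And>n. [d n = shift24_quot s n] (mod 9)"
    using Suc.IH[OF Suc.prems] by (auto simp: P_def T_def)
  obtain e where e: "narayana_rec e" "\<And>n. d (n + T) = d n + P * e n"
    using Suc.IH[OF d(1)] by (auto simp: P_def T_def)
  obtain f where f: "narayana_rec f" "\<And>n. e (n + T) = e n + P * f n"
    using Suc.IH[OF e(1)] by (auto simp: P_def T_def)
  define P' where "P' = (3::int) ^ j"
  have P: "P = 9 * P'" by (simp add: P_def P'_def)
  \<comment> \<open>\<open>3 * P * P'\<close> equals P^2 / 3, so \<open>g\<close> is 3 P d + 3 P^2 e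
    + P^3 f divided by 3 P.\<close>
  define g where "g n = d n + P * e n + 3 * P * P' * f n" for n
  have "narayana_rec g"
    using d(1) e(1) f(1) by (simp add: narayana_rec_def g_def algebra_simps)
  moreover have "s (n + 24 * 3 ^ Suc j) = s n + 3 ^ (Suc j + 2) * g n" for n
  proof -
    have "s (n + 24 * 3 ^ Suc j) = s (n + T + T + T)"
      by (simp add: T_def algebra_simps)
    also have "\<dots> = s n + 3 * P * d n + 3 * P ^ 2 * e n + P ^ 3 * f n"
      by (simp only: d(2) e(2) f(2)) (simp add: power2_eq_square power3_eq_cube algebra_simps)
    also have "\<dots> = s n + 3 * P * g n"
      by (simp add: g_def P power2_eq_square power3_eq_cube algebra_simps)
    finally show ?thesis by (simp add: P_def)
  qed
  moreover have "[g n = shift24_quot s n] (mod 9)" for n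
  proof -
    have "g n = d n + 9 * (P' * e n + 3 * P' * P' * f n)"
      by (simp add: g_def P algebra_simps)
    then have "[g n = d n] (mod 9)" by (simp only: cong_def mod_mult_self2)
    then show ?thesis using d_cong cong_trans by blast
  qed
  ultimately show ?case by blast
qed

text \<open>Each further shift by \<open>24 * 3 ^ j\<close> adds 3^(j+2) times a quotient that is
  constant modulo 9 along \<open>n + 24 * k\<close>, so the total is linear in \<open>m\<close>.
  Knowing the quotient modulo 9 raises the modulus to 3^(j+4).\<close>

lemma narayana_rec_shift_cong:
  assumes "narayana_rec s"
  shows "[s (n + 24 * (3 ^ j * m)) = s n + 3 ^ (j + 2) * (int m * shift24_quot s n)] (mod 3 ^ (j + 4))"
proof (induction m)
  case 0
  then show ?case by simp
next
  case (Suc m)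
  define N where "N = n + 24 * (3 ^ j * m)"
  obtain d where d: "\<And>n. s (n + 24 * 3 ^ j) = s n + 3 ^ (j + 2) * d n"
    and d_cong: "\<And>n. [d n = shift24_quot s n] (mod 9)"
    using narayana_rec_shift_pow3[OF assms] by blast
  \<comment> \<open>The quotient satisfies the recurrence too, so the 24-shift identity applied to
    it gives period 24 modulo 9.\<close>
  have "[shift24_quot s (i + 24) = shift24_quot s i] (mod 9)" for i
    using narayana_rec_shift24[OF narayana_rec_shift24_quot[OF assms]] by (simp add: cong_def)
  then have "[shift24_quot s (n + 24 * k) = shift24_quot s n] (mod 9)" for k
  proof (induction k)
    case (Suc k)
    from Suc.prems[of "n + 24 * k"] Suc.IH[OF Suc.prems] show ?case
      by (simp add: cong_def add.commute add.left_commute)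
  qed simp
  then have "[d N = shift24_quot s n] (mod 9)"
    using d_cong cong_trans unfolding N_def by blast
  then have "[3 ^ (j + 2) * d N = 3 ^ (j + 2) * shift24_quot s n] (mod 3 ^ (j + 2) * 9)"
    by (rule cong_cmult_leftI)
  then have "[3 ^ (j + 2) * d N = 3 ^ (j + 2) * shift24_quot s n] (mod 3 ^ (j + 4))"
    by (simp add: power_add mult.commute)
  from cong_add[OF Suc.IH[folded N_def] this]
  have "[s (N + 24 * 3 ^ j) = s n + 3 ^ (j + 2) * (int (Suc m) * shift24_quot s n)] (mod 3 ^ (j + 4))"
    unfolding d by (simp add: algebra_simps)
  then show ?case
    by (simp add: N_def add_mult_distrib2 add_ac)
qed

section \<open>3-adic valuations from congruences\<close>

lemma multiplicity_eq_of_cong: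
  fixes N e p :: nat and u :: int
  assumes "[int N = int p ^ e * u] (mod int p ^ Suc e)" "\<not> int p dvd u" "p > 0"
  shows "multiplicity p N = e"
proof (rule multiplicity_eqI)
  obtain q where "int N = int p ^ e * u + int p ^ Suc e * q"
    using assms(1) by (metis cong_iff_lin cong_sym)
  then have N: "int N = int p ^ e * (u + int p * q)"
    by (simp add: algebra_simps)
  then have "int (p ^ e) dvd int N"
    by simp
  then show "p ^ e dvd N"
    using of_nat_dvd_iff by blast
  show "\<not> p ^ Suc e dvd N"
  proof
    assume "p ^ Suc e dvd N"
    then have "int (p ^ Suc e) dvd int N"
      using of_nat_dvd_iff by blast
    then have "int p ^ e * int p dvd int p ^ e * (u + int p * q)"
      by (simp add: N mult.commute)
    then have "int p dvd u + int p * q"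
      using \<open>p > 0\<close> by simp
    then show False
      using assms(2) by (simp add: dvd_add_left_iff)
  qed
qed

text \<open>The Narayana sequence run backwards to index \<open>-8\<close>: \<open>narayana_shifted n\<close> is \<open>a\<^sub>n\<^sub>-\<^sub>8\<close>.\<close>

definition narayana_shifted :: "nat \<Rightarrow> int" where
  "narayana_shifted n =
     (if n < 8 then [0, -2, 1, 1, -1, 0, 1, 0] ! n else int (narayana (n - 8)))"

lemma narayana_shifted_add [simp]: "narayana_shifted (n + 8) = int (narayana n)"
  by (simp add: narayana_shifted_def)

lemma narayana_add_3: "narayana (n + 3) = narayana (n + 2) + narayana n"
  by (simp add: numeral_eq_Suc)

lemma narayana_rec_narayana_shifted: "narayana_rec narayana_shifted"
  unfolding narayana_rec_def
proof
  fix n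
  show "narayana_shifted (n + 3) = narayana_shifted (n + 2) + narayana_shifted n"
  proof (cases "n < 8")
    case True
    then have "n \<in> {0, 1, 2, 3, 4, 5, 6, 7}" by auto
    then show ?thesis
      by (auto simp: narayana_shifted_def numeral_eq_Suc)
  next
    case False
    then obtain k where "n = k + 8" by (metis add.commute le_Suc_ex not_less)
    then show ?thesis
      using narayana_shifted_add[of "k + 3"] narayana_shifted_add[of "k + 2"] narayana_add_3[of k]
      by (simp add: add.commute add.left_commute)
  qed
qed

lemma narayana_rec_narayana: "narayana_rec (\<lambda>n. int (narayana n))"
  by (simp add: narayana_rec_def narayana_add_3)

text \<open>The case \<open>j = 0\<close>, reduced from modulus 81 to 27, which detects valuations
  up to 2.\<close>

lemma narayana_mod_27:
  "[int (narayana (r + 24 * k)) =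
    int (narayana r) + 9 * int k * shift24_quot (\<lambda>n. int (narayana n)) r] (mod 27)"
  using narayana_rec_shift_cong[OF narayana_rec_narayana, of r 0 k]
  by (auto simp: mult.assoc intro: cong_dvd_modulus)

text \<open>At a zero \<open>r\<close> only the linear term survives. Writing k = 3^j m with m prime
  to 3, it is 3^(j+2+i) m c with m c prime to 3; the modulus 3^(j+4) sees this power exactly because
  i \<le> 1.\<close>

lemma multiplicity_narayana_near_zero:
  assumes n: "n + 8 = r + 24 * k" and "k > 0" and "narayana_shifted r = 0"
    and B: "shift24_quot narayana_shifted r = 3 ^ i * c" "i \<le> 1" "\<not> 3 dvd c"
  shows "multiplicity 3 (narayana n) = multiplicity 3 k + 2 + i"
proof -
  obtain m where m: "k = 3 ^ multiplicity 3 k * m" "\<not> 3 dvd m"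
    using \<open>k > 0\<close> multiplicity_decompose'[of k 3] by auto
  define j where "j = multiplicity 3 k"
  have "[int (narayana n) = 3 ^ (j + 2) * (int m * (3 ^ i * c))] (mod 3 ^ (j + 4))"
    using narayana_rec_shift_cong[OF narayana_rec_narayana_shifted, of r j m] m(1) assms
    by (metis j_def narayana_shifted_add add_0)
  then have "[int (narayana n) = 3 ^ (j + 2) * (int m * (3 ^ i * c))] (mod 3 ^ Suc (j + 2 + i))"
    using \<open>i \<le> 1\<close> by (elim cong_dvd_modulus) (intro le_imp_power_dvd, simp)
  then have "[int (narayana n) = int 3 ^ (j + 2 + i) * (int m * c)] (mod int 3 ^ Suc (j + 2 + i))"
    by (simp add: power_add mult_ac)
  moreover have "\<not> int 3 dvd int m * c"
    using m(2) B(3) prime_dvd_mult_iff[of "3::int" "int m" c] of_nat_dvd_iff[of 3 m, where 'a=int]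
    by simp
  ultimately show ?thesis
    unfolding j_def[symmetric] by (intro multiplicity_eq_of_cong) auto
qed

text \<open>Converts the valuation of \<open>k\<close> into that of n + 1, n + 3, n or n + 8,
  whichever equals \<open>24 * k\<close> in the class at hand.\<close>

lemma multiplicity_3_mult_24:
  assumes "k > 0"
  shows "multiplicity (3::nat) (24 * k) = multiplicity 3 k + 1"
proof -
  have "multiplicity (3::nat) (3 * (8 * k)) = Suc (multiplicity 3 (8 * k))"
    using assms by (intro multiplicity_times_same) auto
  also have "multiplicity (3::nat) (8 * k) = multiplicity 3 (8::nat) + multiplicity 3 k"
    using assms by (intro prime_elem_multiplicity_mult_distrib) auto
  also have "multiplicity (3::nat) 8 = 0"
    by (intro not_dvd_imp_multiplicity_0) presburger
  finally show ?thesis by simp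
qed

text \<open>The shift term is a multiple of 9, hence invisible modulo 3^(e+1) for e < 2. For e = 2
  the modulus is 27, and a further factor 3 must come from the quotient at \<open>r\<close>.\<close>

lemma multiplicity_3_narayana_const:
  assumes "n = r + 24 * k" and "e \<le> 2" and "int (narayana r) = 3 ^ e * u" and "\<not> 3 dvd u"
    and "e < 2 \<or> 3 dvd shift24_quot (\<lambda>n. int (narayana n)) r"
  shows "multiplicity 3 (narayana n) = e"
proof (rule multiplicity_eq_of_cong)
  define b where "b = shift24_quot (\<lambda>n. int (narayana n)) r"
  have "[int (narayana n) = int (narayana r) + 9 * int k * b] (mod 3 ^ Suc e)"
    using narayana_mod_27[of r k] le_imp_power_dvd[of "Suc e" 3 "3::int"] \<open>e \<le> 2\<close>
    unfolding assms(1) b_def by (auto elim: cong_dvd_modulus)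
  moreover have "3 ^ Suc e dvd 9 * int k * b"
  proof (cases "e < 2")
    case True
    then have "(3::int) ^ Suc e dvd 3 ^ 2" by (intro le_imp_power_dvd) simp
    then show ?thesis by (simp add: mult.assoc)
  next
    case False
    then show ?thesis
      using assms(2,5) by (auto simp: b_def[symmetric] le_Suc_eq numeral_eq_Suc)
  qed
  ultimately show "[int (narayana n) = int 3 ^ e * u] (mod int 3 ^ Suc e)"
    using assms(3) by (simp add: cong_iff_dvd_diff) (smt (verit) dvd_add)
qed (use assms in auto)

section \<open>Numerical values and the residue classes modulo 24\<close>

lemma narayana_values:
  "narayana 1 = 1" "narayana 2 = 1" "narayana 3 = 1" "narayana 4 = 2" "narayana 5 = 3"
  "narayana 6 = 4" "narayana 7 = 6" "narayana 8 = 9" "narayana 9 = 13" "narayana 10 = 19"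
  "narayana 11 = 28" "narayana 12 = 41" "narayana 13 = 60" "narayana 14 = 88"
  "narayana 15 = 129" "narayana 17 = 277" "narayana 18 = 406" "narayana 19 = 595"
  "narayana 20 = 872" "narayana 22 = 1873"
proof -
  show v: "narayana 1 = 1" "narayana 2 = 1" "narayana 3 = 1"
    by (simp_all add: numeral_eq_Suc)
  show v4: "narayana 4 = 2" using narayana_add_3[of 1] by (simp add: v v)
  show v5: "narayana 5 = 3" using narayana_add_3[of 2] by (simp add: v4 v)
  show v6: "narayana 6 = 4" using narayana_add_3[of 3] by (simp add: v5 v)
  show v7: "narayana 7 = 6" using narayana_add_3[of 4] by (simp add: v6 v4)
  show v8: "narayana 8 = 9" using narayana_add_3[of 5] by (simp add: v7 v5)
  show v9: "narayana 9 = 13" using narayana_add_3[of 6] by (simp add: v8 v6)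
  show v10: "narayana 10 = 19" using narayana_add_3[of 7] by (simp add: v9 v7)
  show v11: "narayana 11 = 28" using narayana_add_3[of 8] by (simp add: v10 v8)
  show v12: "narayana 12 = 41" using narayana_add_3[of 9] by (simp add: v11 v9)
  show v13: "narayana 13 = 60" using narayana_add_3[of 10] by (simp add: v12 v10)
  show v14: "narayana 14 = 88" using narayana_add_3[of 11] by (simp add: v13 v11)
  show v15: "narayana 15 = 129" using narayana_add_3[of 12] by (simp add: v14 v12)
  have v16: "narayana 16 = 189" using narayana_add_3[of 13] by (simp add: v15 v13)
  show v17: "narayana 17 = 277" using narayana_add_3[of 14] by (simp add: v16 v14)
  show v18: "narayana 18 = 406" using narayana_add_3[of 15] by (simp add: v17 v15)
  show v19: "narayana 19 = 595" using narayana_add_3[of 16] by (simp add: v18 v16)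
  show v20: "narayana 20 = 872" using narayana_add_3[of 17] by (simp add: v19 v17)
  have v21: "narayana 21 = 1278" using narayana_add_3[of 18] by (simp add: v20 v18)
  show v22: "narayana 22 = 1873" using narayana_add_3[of 19] by (simp add: v21 v19)
qed

theorem theorem1:
  fixes n :: nat
  assumes "n \<ge> 1"
  shows "(n mod 8 \<in> {1, 2, 3, 4, 6} \<longrightarrow> multiplicity 3 (narayana n) = 0) \<and>
         (n mod 24 \<in> {5, 7, 13, 15} \<longrightarrow> multiplicity 3 (narayana n) = 1) \<and>
         (n mod 24 = 8 \<longrightarrow> multiplicity 3 (narayana n) = 2) \<and>
         (n mod 24 = 23 \<longrightarrow> multiplicity 3 (narayana n) = multiplicity 3 (n + 1) + 1) \<and>
         (n mod 24 = 21 \<longrightarrow> multiplicity 3 (narayana n) = multiplicity 3 (n + 3) + 1) \<and>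
         (n mod 24 = 0 \<longrightarrow> multiplicity 3 (narayana n) = multiplicity 3 n + 2) \<and>
         (n mod 24 = 16 \<longrightarrow> multiplicity 3 (narayana n) = multiplicity 3 (n + 8) + 2)"
proof (intro conjI impI)
  define q where "q = n div 24"
  have n: "n = n mod 24 + 24 * q" by (simp add: q_def)
  note const = multiplicity_3_narayana_const[OF n]
  show "multiplicity 3 (narayana n) = 0" if "n mod 8 \<in> {1, 2, 3, 4, 6}"
  proof -
    \<comment> \<open>Each residue modulo 8 lifts to three residues modulo 24; none of the fifteen
      resulting values is divisible by 3.\<close>
    define d where "d = n mod 24 div 8"
    have "n mod 24 mod 8 = n mod 8" by (simp add: mod_mod_cancel)
    then have n24: "n mod 24 = 8 * d + n mod 8"
      unfolding d_def by (metis mult_div_mod_eq)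
    have "d < 3" by (simp add: d_def less_mult_imp_div_less)
    then have "d \<in> {0, 1, 2}" by auto
    with that have "n mod 24 \<in> {1, 2, 3, 4, 6, 9, 10, 11, 12, 14, 17, 18, 19, 20, 22}"
      unfolding n24 by auto
    then show ?thesis
      by (intro const[of 0 "int (narayana (n mod 24))"]) (auto simp: narayana_values)
  qed
  show "multiplicity 3 (narayana n) = 1" if "n mod 24 \<in> {5, 7, 13, 15}"
    using that by (intro const[of 1 "int (narayana (n mod 24)) div 3"]) (auto simp: narayana_values)
  \<comment> \<open>Here a_8 = 9, and the quotient at 8 is 9513 = 3 * 3171, as the case e = 2
    requires.\<close>
  show "multiplicity 3 (narayana n) = 2" if "n mod 24 = 8"
    using that by (intro const[of 2 1]) (auto simp: narayana_values shift24_quot_def)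
  show "multiplicity 3 (narayana n) = multiplicity 3 (n + 1) + 1" if "n mod 24 = 23"
  proof -
    have k: "n + 1 = 24 * (q + 1)" using n that by simp
    \<comment> \<open>\<open>r = 7\<close> is index -1. The terms from there are 0, 0, 1, so the
      quotient is 305.\<close>
    have "multiplicity 3 (narayana n) = multiplicity 3 (q + 1) + 2 + 0"
      by (rule multiplicity_narayana_near_zero[where r = 7 and c = 305])
         (use k in \<open>auto simp: shift24_quot_def narayana_shifted_def narayana_values\<close>)
    then show ?thesis unfolding k by (subst multiplicity_3_mult_24) auto
  qed
  show "multiplicity 3 (narayana n) = multiplicity 3 (n + 3) + 1" if "n mod 24 = 21"
  proof -
    have k: "n + 3 = 24 * (q + 1)" using n that by simp
    \<comment> \<open>Index -3, with terms 0, 1, 0 and quotient 142.\<close>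
    have "multiplicity 3 (narayana n) = multiplicity 3 (q + 1) + 2 + 0"
      by (rule multiplicity_narayana_near_zero[where r = 5 and c = 142])
         (use k in \<open>auto simp: shift24_quot_def narayana_shifted_def narayana_values\<close>)
    then show ?thesis unfolding k by (subst multiplicity_3_mult_24) auto
  qed
  show "multiplicity 3 (narayana n) = multiplicity 3 n + 2" if "n mod 24 = 0"
  proof -
    have k: "n = 24 * q" using n that by simp
    \<comment> \<open>n \<ge> 1 excludes the zero a_0 itself. Below, \<open>r = 8\<close> is index
      0, with terms 0, 1, 1 and quotient 142 + 305 = 3 * 149.\<close>
    have "q > 0" using k assms by simp
    then have "multiplicity 3 (narayana n) = multiplicity 3 q + 2 + 1"
      by (intro multiplicity_narayana_near_zero[where r = 8 and c = 149])
         (use k in \<open>auto simp: shift24_quot_def narayana_shifted_def narayana_values\<close>)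
    with \<open>q > 0\<close> show ?thesis by (subst (2) k) (simp add: multiplicity_3_mult_24)
  qed
  show "multiplicity 3 (narayana n) = multiplicity 3 (n + 8) + 2" if "n mod 24 = 16"
  proof -
    have k: "n + 8 = 24 * (q + 1)" using n that by simp
    \<comment> \<open>Index -8, with terms 0, -2, 1 and quotient -284 + 305 = 3 * 7.\<close>
    have "multiplicity 3 (narayana n) = multiplicity 3 (q + 1) + 2 + 1"
      by (rule multiplicity_narayana_near_zero[where r = 0 and c = 7])
         (use k in \<open>auto simp: shift24_quot_def narayana_shifted_def\<close>)
    then show ?thesis unfolding k by (subst multiplicity_3_mult_24) auto
  qed
qed

end
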